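(* For any forest poset $P$ on $\{1,2,\dots,n\}$, one has $$\mathrm{H}(\mathcal{A}(P);\mathbf{X}) = \frac{\prod_{(i,j)\in\mathrm{Des}(P)}\mathbf{X}^{P_{\le i}}}{\prod_{i=1}^n\left(1-\mathbf{X}^{P_{\le i}}\right)}.$$ In particular, $$\frac{\prod_{(i,j)\in\mathrm{Des}(P)}\mathbf{X}^{P_{\le i}}}{\prod_{i=1}^n\left(1-\mathbf{X}^{P_{\le i}}\right)} = \sum_{w\in\mathcal{L}(P)}\frac{\prod_{i:\,w_i>w_{i+1}}\mathbf{X}^{\{w_1,w_2,\dots,w_i\}}}{\prod_{i=1}^n\left(1-\mathbf{X}^{\{w_1,w_2,\dots,w_i\}}\right)}.$$
   Context: A poset $P$ is a forest if every element is covered by at most one other element. $P_{\le i}=\{j: j\le_P i\}$. The descent set is $\mathrm{Des}(P)=\{(i,j): i\lessdot_P j \text{ and } i>_{\mathbb{Z}} j\}$, where $\lessdot_P$ denotes covering. $\mathcal{A}(P)$ is the set of (strong) $P$-partitions: functions $f:P\to\mathbb{N}=\{0,1,2,\dots\}$ with $f(i)\ge f(j)$ whenever $i<_Pj$ and $f(i)>f(j)$ whenever $(i,j)\in\mathrm{Des}(P)$. Its Hilbert series is $\mathrm{H}(\mathcal{A}(P);\mathbf{X})=\sum_{f\in\mathcal{A}(P)}\mathbf{X}^f$ with $\mathbf{X}^f=\prod_{i=1}^nX_i^{f(i)}$. For $A\subset\{1,\dots,n\}$, $\mathbf{X}^A=\prod_{j\in A}X_j$. $\mathcal{L}(P)$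 is the set of permutations $w=(w_1,\dots,w_n)\in\mathfrak{S}_n$ such that $i<_Pj$ implies $i$ appears before $j$ in $w$; in the product over $i$ with $w_i>w_{i+1}$ one has $1\le i\le n-1$. *)

theory Defs
  imports "HOL-Library.Multiset" "HOL-Library.FuncSet" "HOL-Combinatorics.Permutations"
begin

section \<open>Multivariate formal power series\<close>

text \<open>
  The ring of formal power series with coefficients in \<open>'a\<close> in commuting variables indexed
  by \<open>'v\<close>. A monomial is a finite multiset of variables (the elements of the free commutative
  monoid on \<open>'v\<close>), so a product of monomials is a multiset sum, and a power series is an
  arbitrary function from monomials to coefficients.
\<close>

typedef ('v, 'a) mps = "UNIV :: ('v multiset \<Rightarrow> 'a) set"
  morphisms mcoeff Abs_mps ..

setup_lifting type_definition_mps

lemma mps_eqI: "(\<And>m. mcoeff f m = mcoeff g m) \<Longrightarrow> f = g"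
  by transfer auto

definition splits :: "'v multiset \<Rightarrow> ('v multiset \<times> 'v multiset) set" where
  "splits m = {(a, b). a + b = m}"

lemma finite_submultisets: "finite {a. a \<subseteq># m}"
proof (induction m)
  case (add x m)
  have "{a. a \<subseteq># add_mset x m} \<subseteq> {a. a \<subseteq># m} \<union> add_mset x ` {a. a \<subseteq># m}"
  proof
    fix a assume a: "a \<in> {a. a \<subseteq># add_mset x m}"
    show "a \<in> {a. a \<subseteq># m} \<union> add_mset x ` {a. a \<subseteq># m}"
    proof (cases "x \<in># a")
      case True
      then obtain b where "a = add_mset x b" by (meson mset_add)
      with a show ?thesis by auto
    next
      case False
      have "a \<subseteq># m"
      proof (rule mset_subset_eqI)
        fix y
        have "count a y \<le> count (add_mset x m) y"
          using a by (intro mset_subset_eq_count) simp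
        with False show "count a y \<le> count m y"
          by (cases "y = x") (auto simp: not_in_iff)
      qed
      then show ?thesis by simp
    qed
  qed
  with add.IH show ?case by (meson finite_UnI finite_imageI finite_subset)
qed simp

lemma finite_splits [simp]: "finite (splits m)"
proof -
  have "splits m \<subseteq> {a. a \<subseteq># m} \<times> {a. a \<subseteq># m}"
    by (auto simp: splits_def)
  then show ?thesis using finite_submultisets finite_subset by blast
qed

instantiation mps :: (type, comm_ring_1) comm_ring_1
begin

lift_definition zero_mps :: "('a, 'b) mps" is "\<lambda>_. 0" .
lift_definition one_mps :: "('a, 'b) mps" is "\<lambda>m. if m = {#} then 1 else 0" .
lift_definition plus_mps :: "('a, 'b) mps \<Rightarrow> ('a, 'b) mps \<Rightarrow> ('a, 'b) mps"
  is "\<lambda>f g m. f m + g m" .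
lift_definition minus_mps :: "('a, 'b) mps \<Rightarrow> ('a, 'b) mps \<Rightarrow> ('a, 'b) mps"
  is "\<lambda>f g m. f m - g m" .
lift_definition uminus_mps :: "('a, 'b) mps \<Rightarrow> ('a, 'b) mps"
  is "\<lambda>f m. - f m" .
lift_definition times_mps :: "('a, 'b) mps \<Rightarrow> ('a, 'b) mps \<Rightarrow> ('a, 'b) mps"
  is "\<lambda>f g m. \<Sum>(a, b)\<in>splits m. f a * g b" .

instance
proof
  fix f g h :: "('a, 'b) mps"
  show "f * g * h = f * (g * h)"
  proof (transfer, rule ext)
    fix f g h :: "'a multiset \<Rightarrow> 'b" and m
    have "(\<Sum>(a, b)\<in>splits m. (\<Sum>(c, d)\<in>splits a. f c * g d) * h b)
        = (\<Sum>p\<in>splits m. \<Sum>q\<in>splits (fst p). f (fst q) * g (snd q) * h (snd p))"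
      by (simp add: sum_distrib_right case_prod_unfold)
    also have "\<dots> = (\<Sum>(p, q)\<in>(SIGMA p:splits m. splits (fst p)).
                      f (fst q) * g (snd q) * h (snd p))"
      by (subst sum.Sigma) auto
    also have "\<dots> = (\<Sum>(p, q)\<in>(SIGMA p:splits m. splits (snd p)).
                      f (fst p) * (g (fst q) * h (snd q)))"
      by (rule sum.reindex_bij_witness
            [where i = "\<lambda>(p, q). ((fst p + fst q, snd q), (fst p, fst q))"
               and j = "\<lambda>(p, q). ((fst q, snd q + snd p), (snd q, snd p))"])
        (auto simp: splits_def algebra_simps)
    also have "\<dots> = (\<Sum>p\<in>splits m. \<Sum>q\<in>splits (snd p). f (fst p) * (g (fst q) * h (snd q)))"
      by (subst sum.Sigma) auto
    also have "\<dots> = (\<Sum>(a, b)\<in>splits m. f a * (\<Sum>(c, d)\<in>splits b. g c * h d))"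
      by (simp add: sum_distrib_left case_prod_unfold)
    finally show "(\<Sum>(a, b)\<in>splits m. (\<Sum>(c, d)\<in>splits a. f c * g d) * h b)
        = (\<Sum>(a, b)\<in>splits m. f a * (\<Sum>(c, d)\<in>splits b. g c * h d))" .
  qed
  show "f * g = g * f"
  proof (transfer, rule ext)
    fix f g :: "'a multiset \<Rightarrow> 'b" and m
    show "(\<Sum>(a, b)\<in>splits m. f a * g b) = (\<Sum>(a, b)\<in>splits m. g a * f b)"
      by (rule sum.reindex_bij_witness[where i = prod.swap and j = prod.swap])
        (auto simp: splits_def algebra_simps)
  qed
  show "1 * f = f"
  proof (transfer, rule ext)
    fix f :: "'a multiset \<Rightarrow> 'b" and m
    have "(\<Sum>(a, b)\<in>splits m. (if a = {#} then 1 else 0) * f b)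
        = (\<Sum>(a, b)\<in>{({#} :: 'a multiset, m)}. (if a = {#} then 1 else 0) * f b)"
      by (intro sum.mono_neutral_right finite_splits) (auto simp: splits_def split: if_splits)
    then show "(\<Sum>(a, b)\<in>splits m. (if a = {#} then 1 else 0) * f b) = f m"
      by simp
  qed
  show "(f + g) * h = f * h + g * h"
    by (transfer, rule ext) (simp add: algebra_simps case_prod_unfold sum.distrib)
  show "0 \<noteq> (1 :: ('a, 'b) mps)"
    by transfer (auto dest: fun_cong[where x = "{#}"])
qed (transfer; simp add: fun_eq_iff algebra_simps)+

end

text \<open>
  Fractions: \<open>f / g\<close> is \<open>f\<close> times the inverse of \<open>g\<close> in the power series ring.
  As usual, the inverse of a non-unit is set to \<open>0\<close>; the lemma \<open>mps_inverse_one_minus\<close> below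
  shows that this junk value is irrelevant for denominators of the form \<open>1 - u\<close> where \<open>u\<close> has
  no constant term.
\<close>

instantiation mps :: (type, comm_ring_1) inverse
begin

definition inverse_mps_def:
  "inverse (g :: ('a, 'b) mps) = (if g dvd 1 then THE h. g * h = 1 else 0)"

definition divide_mps_def:
  "(f :: ('a, 'b) mps) div g = f * inverse g"

instance ..

end

definition mps_Var :: "'v \<Rightarrow> ('v, 'a::comm_ring_1) mps" where
  "mps_Var v = Abs_mps (\<lambda>m. if m = {#v#} then 1 else 0)"

text \<open>
  The formal sum of a possibly infinite family of power series, formed coefficientwise. It is
  meaningful when every monomial occurs in only finitely many members of the family.
\<close>

definition mps_Sum :: "('i \<Rightarrow> ('v, 'a::comm_ring_1) mps) \<Rightarrow> 'i set \<Rightarrow> ('v, 'a) mps" where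
  "mps_Sum F I = Abs_mps (\<lambda>m. \<Sum>i\<in>{i \<in> I. mcoeff (F i) m \<noteq> 0}. mcoeff (F i) m)"

lemma mps_inverse_eqI:
  assumes "g * h = (1 :: ('v, 'a::comm_ring_1) mps)"
  shows "inverse g = h"
proof -
  have "h' = h" if "g * h' = 1" for h'
  proof -
    have "h' = (g * h) * h'" by (simp add: assms)
    also have "\<dots> = h * (g * h')" by (simp only: mult_ac)
    finally show ?thesis by (simp add: that)
  qed
  with assms have "(THE h'. g * h' = 1) = h" by (rule the_equality)
  moreover have "g dvd 1" using assms[symmetric] by (rule dvdI)
  ultimately show ?thesis by (simp add: inverse_mps_def)
qed

lemma mps_divide_eq_iff:
  assumes "g dvd (1 :: ('v, 'a::comm_ring_1) mps)"
  shows "f / g = h \<longleftrightarrow> f = h * g"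
proof -
  from assms obtain k where k: "1 = g * k" by (rule dvdE)
  have "f * k = h \<longleftrightarrow> f = h * g"
  proof
    assume "f * k = h"
    then have "h * g = f * (g * k)" by (simp only: mult_ac flip: \<open>f * k = h\<close>)
    then show "f = h * g" by (simp add: k[symmetric])
  next
    assume "f = h * g"
    then have "f * k = h * (g * k)" by (simp only: mult_ac)
    then show "f * k = h" by (simp add: k[symmetric])
  qed
  then show ?thesis
    by (simp add: divide_mps_def mps_inverse_eqI[OF k[symmetric]])
qed

lemma mcoeff_zero [simp]: "mcoeff 0 m = 0"
  and mcoeff_one: "mcoeff 1 m = (if m = {#} then 1 else 0)"
  and mcoeff_add [simp]: "mcoeff (f + g) m = mcoeff f m + mcoeff g m"
  and mcoeff_diff [simp]: "mcoeff (f - g) m = mcoeff f m - mcoeff g m"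
  and mcoeff_mult: "mcoeff (f * g) m = (\<Sum>(a, b)\<in>splits m. mcoeff f a * mcoeff g b)"
  by (transfer; simp)+

lemma mcoeff_sum: "mcoeff (\<Sum>i\<in>I. F i) m = (\<Sum>i\<in>I. mcoeff (F i) m)"
  by (induction I rule: infinite_finite_induct) auto

lemma mcoeff_Var: "mcoeff (mps_Var v) m = (if m = {#v#} then 1 else 0)"
  by (simp add: mps_Var_def Abs_mps_inverse)

lemma mcoeff_power_low:
  assumes "mcoeff u {#} = 0" "size m < k"
  shows "mcoeff (u ^ k) m = 0"
  using assms(2)
proof (induction k arbitrary: m)
  case (Suc k)
  have "mcoeff u a * mcoeff (u ^ k) b = 0" if "a + b = m" for a b
  proof (cases "a = {#}")
    case False
    then have "size a \<noteq> 0" by simp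
    moreover have "size m = size a + size b" using that by auto
    ultimately have "size b < k" using Suc.prems by linarith
    then show ?thesis using Suc.IH by simp
  qed (simp add: assms(1))
  then show ?case by (auto simp: mcoeff_mult splits_def intro!: sum.neutral)
qed simp

lemma mps_unit_one_minus:
  assumes "mcoeff u {#} = 0"
  shows "(1 - u) dvd (1 :: ('v, 'a::comm_ring_1) mps)"
proof -
  define g where "g = Abs_mps (\<lambda>m. \<Sum>k\<le>size m. mcoeff (u ^ k) m)"
  have g: "mcoeff g b = mcoeff (\<Sum>k\<le>N. u ^ k) b" if "size b \<le> N" for b N
  proof -
    have "(\<Sum>k\<le>N. mcoeff (u ^ k) b) = (\<Sum>k\<le>size b. mcoeff (u ^ k) b)"
      using that by (intro sum.mono_neutral_right) (auto simp: mcoeff_power_low assms)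
    then show ?thesis by (simp add: g_def Abs_mps_inverse mcoeff_sum)
  qed
  have "(1 - u) * g = 1"
  proof (rule mps_eqI)
    fix m
    have "mcoeff ((1 - u) * g) m = mcoeff ((1 - u) * (\<Sum>k\<le>size m. u ^ k)) m"
      unfolding mcoeff_mult
    proof (rule sum.cong)
      fix p assume "p \<in> splits m"
      then have "size (snd p) \<le> size m" by (auto simp: splits_def)
      from g[OF this]
      show "(case p of (a, b) \<Rightarrow> mcoeff (1 - u) a * mcoeff g b) =
          (case p of (a, b) \<Rightarrow> mcoeff (1 - u) a * mcoeff (\<Sum>k\<le>size m. u ^ k) b)"
        by (simp add: case_prod_unfold)
    qed simp
    also have "(1 - u) * (\<Sum>k\<le>size m. u ^ k) = 1 - u ^ Suc (size m)"
      by (metis one_diff_power_eq lessThan_Suc_atMost)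
    also have "mcoeff \<dots> m = mcoeff 1 m"
      by (simp add: mcoeff_power_low[OF assms] del: power_Suc)
    finally show "mcoeff ((1 - u) * g) m = mcoeff 1 m" .
  qed
  from this[symmetric] show ?thesis by (rule dvdI)
qed

lemma mps_inverse_one_minus:
  assumes "mcoeff u {#} = 0"
  shows "(1 - u) * inverse (1 - u) = (1 :: ('v, 'a::comm_ring_1) mps)"
proof -
  from mps_unit_one_minus[OF assms] obtain h where "1 = (1 - u) * h" by (rule dvdE)
  with mps_inverse_eqI[OF this[symmetric]] show ?thesis by simp
qed


section \<open>Posets on an initial segment of the positive integers\<close>

text \<open>
  A poset on \<open>{1..n}\<close> is a relation \<open>P\<close> with \<^term>\<open>partial_order_on {1..n} P\<close>, where
  \<open>(i, j) \<in> P\<close> means that \<open>i\<close> is weakly below \<open>j\<close>.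
\<close>

definition strictly_below :: "nat rel \<Rightarrow> nat \<Rightarrow> nat \<Rightarrow> bool" where
  "strictly_below P i j \<longleftrightarrow> (i, j) \<in> P \<and> i \<noteq> j"

definition covered_by :: "nat rel \<Rightarrow> nat \<Rightarrow> nat \<Rightarrow> bool" where
  "covered_by P i j \<longleftrightarrow>
     strictly_below P i j \<and> \<not> (\<exists>k. strictly_below P i k \<and> strictly_below P k j)"

definition forest :: "nat rel \<Rightarrow> bool" where
  "forest P \<longleftrightarrow> (\<forall>i j k. covered_by P i j \<longrightarrow> covered_by P i k \<longrightarrow> j = k)"

definition down_set :: "nat rel \<Rightarrow> nat \<Rightarrow> nat set" where
  "down_set P i = {j. (j, i) \<in> P}"

definition Des :: "nat rel \<Rightarrow> (nat \<times> nat) set" where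
  "Des P = {(i, j). covered_by P i j \<and> i > j}"

definition P_partitions :: "nat \<Rightarrow> nat rel \<Rightarrow> (nat \<Rightarrow> nat) set" where
  "P_partitions n P = {f \<in> {1..n} \<rightarrow>\<^sub>E UNIV.
     (\<forall>i j. strictly_below P i j \<longrightarrow> f i \<ge> f j) \<and> (\<forall>(i, j)\<in>Des P. f i > f j)}"

text \<open>The permutation \<open>w\<close> stands for the word \<open>w 1, w 2, \<dots>, w n\<close>.\<close>

definition linear_extensions :: "nat \<Rightarrow> nat rel \<Rightarrow> (nat \<Rightarrow> nat) set" where
  "linear_extensions n P = {w. w permutes {1..n} \<and>
     (\<forall>a\<in>{1..n}. \<forall>b\<in>{1..n}. strictly_below P (w a) (w b) \<longrightarrow> a < b)}"

definition X_set :: "nat set \<Rightarrow> (nat, int) mps" where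
  "X_set A = (\<Prod>j\<in>A. mps_Var j)"

lemma one_minus_X_set_unit:
  assumes "finite A" "A \<noteq> {}"
  shows "(1 - X_set A) dvd 1"
proof (rule mps_unit_one_minus)
  from assms obtain j where "j \<in> A" by blast
  with assms(1) have "X_set A = mps_Var j * (\<Prod>i\<in>A - {j}. mps_Var i)"
    by (simp add: X_set_def prod.remove)
  then show "mcoeff (X_set A) {#} = 0"
    by (auto simp: mcoeff_mult mcoeff_Var splits_def intro!: sum.neutral)
qed

definition X_pow :: "nat \<Rightarrow> (nat \<Rightarrow> nat) \<Rightarrow> (nat, int) mps" where
  "X_pow n f = (\<Prod>i=1..n. mps_Var i ^ f i)"

text \<open>
  Distinct functions on \<open>{1..n}\<close> have distinct monomials, so the formal sum below is meaningful
  for every set \<open>A\<close> of such functions.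
\<close>

definition Hilbert :: "nat \<Rightarrow> (nat \<Rightarrow> nat) set \<Rightarrow> (nat, int) mps" where
  "Hilbert n A = mps_Sum (X_pow n) A"

end

theory Submission
  imports Defs "HOL-Library.Product_Lexorder"
begin

text \<open>
  Call \<open>f i\<close> minus the value of \<open>f\<close> at the unique cover of \<open>i\<close> (or minus \<open>0\<close> if \<open>i\<close> is a root)
  the slack of \<open>f\<close> at \<open>i\<close>. On a forest, a \<open>P\<close>-partition is a function whose slack is at least
  \<open>1\<close> at the lower ends of descents and at least \<open>0\<close> elsewhere; these conditions are independent
  of each other. Raising \<open>f\<close> by \<open>1\<close> on the whole principal ideal below \<open>t\<close> raises the slack at \<open>t\<close>
  by \<open>1\<close> and changes no other slack, because a point strictly below \<open>t\<close> has its cover below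
  \<open>t\<close> as well; on monomials it is multiplication by \<open>\<^bold>X\<close> to the power of that ideal
  (\<open>slack_series_shift\<close>). So each descent contributes one factor to the numerator, and
  allowing arbitrary slack at \<open>t\<close> instead of minimal slack contributes a geometric series, that is,
  one factor of the denominator (\<open>slack_series_free\<close>). With every slack prescribed to be \<open>0\<close>, only
  \<open>f = 0\<close> remains.

  For the second identity, order labels by the key \<open>(- f i, i)\<close>, lexicographically. On any poset,
  \<open>f\<close> is a \<open>P\<close>-partition exactly when the key strictly increases along \<open>P\<close>
  (\<open>P_partitions_iff_partition_key\<close>): strictness at covering descents propagates along saturated
  chains.
  Sorting the labels by key therefore assigns to each \<open>P\<close>-partition a linear extension \<open>w\<close>, and the
  functions sent to \<open>w\<close> are the partitions of the chain \<open>w 1 < w 2 < \<dots> < w n\<close>. A chain is a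
  forest whose principal ideals are the sets of initial letters of \<open>w\<close>, so the first identity
  evaluates every summand.
\<close>

section \<open>Power series with coefficients zero and one\<close>

definition monomial_series :: "'v multiset set \<Rightarrow> ('v, 'a::comm_ring_1) mps" where
  "monomial_series M = Abs_mps (\<lambda>m. of_bool (m \<in> M))"

lemma mcoeff_monomial_series: "mcoeff (monomial_series M) m = of_bool (m \<in> M)"
  by (simp add: monomial_series_def Abs_mps_inverse)

lemma monomial_series_one: "monomial_series {{#}} = 1"
  by (rule mps_eqI) (simp add: mcoeff_monomial_series mcoeff_one)

lemma monomial_series_Un:
  assumes "M \<inter> N = {}"
  shows "monomial_series (M \<union> N) = monomial_series M + monomial_series N"
  using assms by (intro mps_eqI) (auto simp: mcoeff_monomial_series)

lemma monomial_series_UN: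
  assumes "finite I" "disjoint_family_on M I"
  shows "monomial_series (\<Union>i\<in>I. M i) = (\<Sum>i\<in>I. monomial_series (M i))"
  using assms
proof (induction I rule: finite_induct)
  case empty
  show ?case by (rule mps_eqI) (simp add: mcoeff_monomial_series)
next
  case (insert i I)
  then have "M i \<inter> (\<Union>j\<in>I. M j) = {}"
    by (auto simp: disjoint_family_on_def)
  moreover have "disjoint_family_on M I"
    using insert.prems by (auto simp: disjoint_family_on_def)
  ultimately show ?case
    using insert by (simp add: monomial_series_Un)
qed

lemma monomial_series_shift:
  "monomial_series {a} * monomial_series M = monomial_series ((+) a ` M)"
proof (rule mps_eqI)
  fix m
  have "mcoeff (monomial_series {a} * monomial_series M) m
      = (\<Sum>(b, c)\<in>splits m. if b = a \<and> c \<in> M then 1 else 0)"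
    by (auto simp: mcoeff_mult mcoeff_monomial_series intro!: sum.cong)
  also have "\<dots> = (\<Sum>(b, c)\<in>(if m \<in> (+) a ` M then {(a, m - a)} else {}). 1)"
    by (rule sum.mono_neutral_cong_right[OF finite_splits])
      (auto simp: splits_def split: if_splits)
  also have "\<dots> = of_bool (m \<in> (+) a ` M)" by simp
  finally show "mcoeff (monomial_series {a} * monomial_series M) m
      = mcoeff (monomial_series ((+) a ` M)) m"
    by (simp add: mcoeff_monomial_series)
qed

lemma monomial_series_mult: "monomial_series {a} * monomial_series {b} = monomial_series {a + b}"
  by (simp add: monomial_series_shift)

lemma monomial_series_prod:
  "(\<Prod>i\<in>I. monomial_series {a i}) = monomial_series {\<Sum>i\<in>I. a i}"
  by (induction I rule: infinite_finite_induct)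
    (simp_all add: monomial_series_one monomial_series_mult)

lemma mps_Var_eq: "mps_Var v = monomial_series {{#v#}}"
  by (rule mps_eqI) (simp add: mcoeff_Var mcoeff_monomial_series)

lemma mps_Var_power_eq: "mps_Var v ^ k = monomial_series {replicate_mset k v}"
  by (induction k) (simp_all add: monomial_series_one mps_Var_eq monomial_series_mult)

lemma X_set_eq: "X_set A = monomial_series {mset_set A}"
  by (simp add: X_set_def mps_Var_eq monomial_series_prod)

definition exponent :: "nat \<Rightarrow> (nat \<Rightarrow> nat) \<Rightarrow> nat multiset" where
  "exponent n f = (\<Sum>i=1..n. replicate_mset (f i) i)"

lemma count_exponent: "count (exponent n f) i = (if i \<in> {1..n} then f i else 0)"
proof -
  have "count (exponent n f) i = (\<Sum>j=1..n. if j = i then f j else 0)"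
    unfolding exponent_def count_sum by (rule sum.cong) auto
  then show ?thesis by simp
qed

lemma inj_on_exponent: "inj_on (exponent n) ({1..n} \<rightarrow>\<^sub>E UNIV)"
proof (rule inj_onI)
  fix f g assume fg: "f \<in> {1..n} \<rightarrow>\<^sub>E UNIV" "g \<in> {1..n} \<rightarrow>\<^sub>E UNIV"
    and eq: "exponent n f = exponent n g"
  show "f = g"
  proof (rule PiE_ext[OF fg])
    fix i assume "i \<in> {1..n}"
    with arg_cong[OF eq, of "\<lambda>m. count m i"] show "f i = g i"
      by (simp add: count_exponent)
  qed
qed

lemma X_pow_eq: "X_pow n f = monomial_series {exponent n f}"
  by (simp add: X_pow_def mps_Var_power_eq monomial_series_prod exponent_def)

lemma Hilbert_eq:
  assumes "A \<subseteq> {1..n} \<rightarrow>\<^sub>E UNIV"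
  shows "Hilbert n A = monomial_series (exponent n ` A)"
proof (rule mps_eqI)
  fix m
  have inj: "inj_on (exponent n) A"
    using inj_on_exponent assms by (rule inj_on_subset)
  have "{f \<in> A. mcoeff (X_pow n f) m \<noteq> 0} = {f \<in> A. exponent n f = m}"
    by (auto simp: X_pow_eq mcoeff_monomial_series)
  then have "mcoeff (Hilbert n A) m = (\<Sum>f\<in>{f \<in> A. exponent n f = m}. 1)"
    by (auto simp: Hilbert_def mps_Sum_def Abs_mps_inverse X_pow_eq mcoeff_monomial_series
        intro!: sum.cong)
  also have "\<dots> = of_bool (m \<in> exponent n ` A)"
  proof (cases "m \<in> exponent n ` A")
    case True
    then obtain f where "f \<in> A" "m = exponent n f" by blast
    then have "{g \<in> A. exponent n g = m} = {f}"
      using inj by (auto dest: inj_onD)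
    then show ?thesis using True by simp
  next
    case False
    then have empty: "{g \<in> A. exponent n g = m} = {}" by blast
    show ?thesis unfolding empty using False by simp
  qed
  finally show "mcoeff (Hilbert n A) m = mcoeff (monomial_series (exponent n ` A)) m"
    by (simp add: mcoeff_monomial_series)
qed

section \<open>Strictness along saturated chains\<close>

locale labeled_poset =
  fixes n :: nat and P :: "nat rel"
  assumes poset: "partial_order_on {1..n} P"
begin

lemma P_subset: "P \<subseteq> {1..n} \<times> {1..n}"
  and P_refl: "i \<in> {1..n} \<Longrightarrow> (i, i) \<in> P"
  and P_trans: "(i, j) \<in> P \<Longrightarrow> (j, k) \<in> P \<Longrightarrow> (i, k) \<in> P"
  and P_antisym: "(i, j) \<in> P \<Longrightarrow> (j, i) \<in> P \<Longrightarrow> i = j"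
  using partial_order_onD[OF poset] by (auto simp: refl_on_def dest: transD antisymD)

lemma finite_P: "finite P"
  using P_subset by (rule finite_subset) simp

lemma finite_Des: "finite (Des P)"
  by (rule finite_subset[OF _ finite_P]) (auto simp: Des_def covered_by_def strictly_below_def)

lemma covered_byD:
  assumes "covered_by P i j"
  shows "(i, j) \<in> P" "i \<noteq> j" "strictly_below P i j" "i \<in> {1..n}" "j \<in> {1..n}"
  using assms P_subset by (auto simp: covered_by_def strictly_below_def)

text \<open>
  Induction on the size of the closed interval: an interval that is not a covering pair splits at
  an interior point into two smaller intervals.
\<close>

lemma strictly_below_induct [consumes 1, case_names cover split]:
  assumes "strictly_below P i j"
    and cover: "\<And>i j. covered_by P i j \<Longrightarrow> Q i j"
    and split: "\<And>i j k. strictly_below P i k \<Longrightarrow> strictly_below P k j \<Longrightarrow> Q i k \<Longrightarrow> Q k j \<Longrightarrow> Q i j"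
  shows "Q i j"
  using assms(1)
proof (induction "card {k. (i, k) \<in> P \<and> (k, j) \<in> P}" arbitrary: i j rule: less_induct)
  case less
  show ?case
  proof (cases "covered_by P i j")
    case False
    with less.prems obtain k where k: "strictly_below P i k" "strictly_below P k j"
      by (auto simp: covered_by_def)
    have mem: "(i, k) \<in> P" "(k, j) \<in> P" "i \<noteq> k" "k \<noteq> j"
      using k by (auto simp: strictly_below_def)
    have ends: "i \<in> {1..n}" "j \<in> {1..n}" using mem P_subset by auto
    have fin: "finite {k. (i, k) \<in> P \<and> (k, j) \<in> P}"
      by (rule finite_subset[of _ "{1..n}"]) (use P_subset in auto)
    have "{l. (i, l) \<in> P \<and> (l, k) \<in> P} \<subset> {l. (i, l) \<in> P \<and> (l, j) \<in> P}"
      using mem ends P_refl P_trans P_antisym by blast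
    moreover have "{l. (k, l) \<in> P \<and> (l, j) \<in> P} \<subset> {l. (i, l) \<in> P \<and> (l, j) \<in> P}"
      using mem ends P_refl P_trans P_antisym by blast
    ultimately show ?thesis
      using split[OF k] less.hyps k psubset_card_mono[OF fin] by meson
  qed (rule cover)
qed

end

definition partition_key :: "(nat \<Rightarrow> nat) \<Rightarrow> nat \<Rightarrow> int \<times> nat" where
  "partition_key f i = (- int (f i), i)"

lemma inj_partition_key: "inj_on (partition_key f) A"
  by (auto simp: inj_on_def partition_key_def)

lemma partition_key_less_iff:
  "partition_key f i < partition_key f j \<longleftrightarrow> f j \<le> f i \<and> i \<noteq> j \<and> (i > j \<longrightarrow> f j < f i)"
  by (auto simp: partition_key_def)

text \<open>
  The definition of a \<open>P\<close>-partition demands strictness only at covering descents. The key condition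
  is transitive, so it passes from covering pairs to all comparable pairs.
\<close>

lemma (in labeled_poset) P_partitions_iff_partition_key:
  "f \<in> P_partitions n P \<longleftrightarrow> f \<in> {1..n} \<rightarrow>\<^sub>E UNIV \<and>
     (\<forall>i j. strictly_below P i j \<longrightarrow> partition_key f i < partition_key f j)" (is "?L \<longleftrightarrow> ?R")
proof
  assume L: ?L
  have "partition_key f i < partition_key f j" if "strictly_below P i j" for i j
    using that
  proof (induction rule: strictly_below_induct)
    case (cover i j)
    with L covered_byD[OF cover] show ?case
      by (auto simp: partition_key_less_iff P_partitions_def Des_def)
  next
    case (split i j k)
    then show ?case by order
  qed
  with L show ?R by (auto simp: P_partitions_def)
next
  assume R: ?R
  then have "f j \<le> f i" if "strictly_below P i j" for i j
    using that by (auto simp: partition_key_less_iff)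
  moreover have "f j < f i" if "(i, j) \<in> Des P" for i j
  proof -
    from that have "covered_by P i j" "i > j" by (auto simp: Des_def)
    with R covered_byD(3) show ?thesis by (auto simp: partition_key_less_iff)
  qed
  ultimately show ?L using R by (auto simp: P_partitions_def)
qed

section \<open>Partitions of a forest\<close>

locale labeled_forest = labeled_poset +
  assumes forest: "forest P"
begin

text \<open>
  At most one element covers \<open>i\<close>, so the sum is the value at that element, or \<open>0\<close> at a root.
\<close>

definition cover_value :: "(nat \<Rightarrow> nat) \<Rightarrow> nat \<Rightarrow> nat" where
  "cover_value f i = (\<Sum>j\<in>{j. covered_by P i j}. f j)"

lemma cover_unique: "covered_by P i j \<Longrightarrow> covered_by P i k \<Longrightarrow> j = k"
  using forest by (auto simp: forest_def)

lemma cover_value_eq: "covered_by P i j \<Longrightarrow> cover_value f i = f j"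
proof -
  assume "covered_by P i j"
  then have "{k. covered_by P i k} = {j}" by (auto dest: cover_unique)
  then show ?thesis by (simp add: cover_value_def)
qed

lemma cover_value_root: "(\<And>j. \<not> covered_by P i j) \<Longrightarrow> cover_value f i = 0"
  by (simp add: cover_value_def)

lemma cover_below:
  assumes "strictly_below P i t"
  shows "\<exists>j. covered_by P i j \<and> (j, t) \<in> P"
  using assms
proof (induction rule: strictly_below_induct)
  case (cover i j)
  with covered_byD(5)[OF cover] show ?case using P_refl by blast
next
  case (split i j k)
  then show ?case using P_trans by (auto simp: strictly_below_def)
qed

definition raise_below :: "nat \<Rightarrow> (nat \<Rightarrow> nat) \<Rightarrow> nat \<Rightarrow> nat" where
  "raise_below t f = restrict (\<lambda>i. f i + of_bool ((i, t) \<in> P)) {1..n}"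

text \<open>
  Here the forest hypothesis matters: if \<open>i < t\<close>, then the only cover of \<open>i\<close> lies below \<open>t\<close> and
  is raised together with \<open>i\<close>. So only the slack at \<open>t\<close> changes.
\<close>

lemma cover_value_raise_below:
  "cover_value (raise_below t f) i = cover_value f i + of_bool (strictly_below P i t)"
proof (cases "\<exists>j. covered_by P i j")
  case True
  then obtain j where j: "covered_by P i j" by blast
  note jD = covered_byD[OF j]
  have "(j, t) \<in> P \<longleftrightarrow> strictly_below P i t"
  proof
    assume "(j, t) \<in> P"
    then show "strictly_below P i t"
      using jD P_trans P_antisym unfolding strictly_below_def by blast
  next
    assume "strictly_below P i t"
    then show "(j, t) \<in> P" using cover_below cover_unique j by blast
  qed
  then show ?thesis using jD by (simp add: cover_value_eq[OF j] raise_below_def)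
next
  case False
  then have "\<not> strictly_below P i t" using cover_below by blast
  with False show ?thesis by (simp add: cover_value_root)
qed

text \<open>
  Two parameters, because numerator and denominator arise separately: \<open>d\<close> is the prescribed minimal
  slack, and \<open>S\<close> is the set of points at which larger slack is admitted.
\<close>

definition slack_partitions :: "(nat \<Rightarrow> nat) \<Rightarrow> nat set \<Rightarrow> (nat \<Rightarrow> nat) set" where
  "slack_partitions d S = {f \<in> {1..n} \<rightarrow>\<^sub>E UNIV. \<forall>i\<in>{1..n}.
     cover_value f i + d i \<le> f i \<and> (i \<notin> S \<longrightarrow> f i = cover_value f i + d i)}"

lemma slack_partitionsD:
  assumes "f \<in> slack_partitions d S"
  shows "f \<in> {1..n} \<rightarrow>\<^sub>E UNIV"
    and "i \<in> {1..n} \<Longrightarrow> cover_value f i + d i \<le> f i"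
    and "i \<in> {1..n} \<Longrightarrow> i \<notin> S \<Longrightarrow> f i = cover_value f i + d i"
  using assms unfolding slack_partitions_def by blast+

lemma raise_below_in_slack_partitions:
  assumes f: "f \<in> {1..n} \<rightarrow>\<^sub>E UNIV"
  shows "raise_below t f \<in> slack_partitions (d(t := Suc (d t))) S \<longleftrightarrow> f \<in> slack_partitions d S"
proof -
  have "cover_value (raise_below t f) i + (d(t := Suc (d t))) i \<le> raise_below t f i \<longleftrightarrow>
        cover_value f i + d i \<le> f i" (is ?le)
    and "raise_below t f i = cover_value (raise_below t f) i + (d(t := Suc (d t))) i \<longleftrightarrow>
        f i = cover_value f i + d i" (is ?eq)
    if "i \<in> {1..n}" for i
  proof -
    have "cover_value (raise_below t f) i + (d(t := Suc (d t))) i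
        = cover_value f i + d i + of_bool ((i, t) \<in> P)"
      using P_refl[OF that] by (auto simp: cover_value_raise_below strictly_below_def)
    moreover have "raise_below t f i = f i + of_bool ((i, t) \<in> P)"
      using that by (simp add: raise_below_def)
    ultimately show ?le ?eq by auto
  qed
  moreover have "raise_below t f \<in> {1..n} \<rightarrow>\<^sub>E UNIV" by (simp add: raise_below_def)
  ultimately show ?thesis using f unfolding slack_partitions_def by auto
qed

lemma slack_partitions_antimono:
  assumes "f \<in> slack_partitions d S" "(i, j) \<in> P"
  shows "f j \<le> f i"
proof (cases "i = j")
  case False
  then have "strictly_below P i j" using assms(2) by (simp add: strictly_below_def)
  then show ?thesis
  proof (induction rule: strictly_below_induct)
    case (cover i j)
    have "cover_value f i + d i \<le> f i"
      using assms(1) covered_byD(4)[OF cover] by (rule slack_partitionsD)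
    then show ?case by (simp add: cover_value_eq[OF cover])
  next
    case (split i j k)
    then show ?case by simp
  qed
qed simp

lemma raise_below_slack_partitions:
  "raise_below t ` slack_partitions d S = slack_partitions (d(t := Suc (d t))) S"
  (is "_ = ?R") if t: "t \<in> {1..n}"
proof
  show "raise_below t ` slack_partitions d S \<subseteq> ?R"
    using raise_below_in_slack_partitions slack_partitionsD(1) by blast
next
  show "?R \<subseteq> raise_below t ` slack_partitions d S"
  proof
    fix f assume f: "f \<in> ?R"
    define g where "g = restrict (\<lambda>i. f i - of_bool ((i, t) \<in> P)) {1..n}"
    have fE: "f \<in> {1..n} \<rightarrow>\<^sub>E UNIV" using f by (rule slack_partitionsD)
    \<comment> \<open>Positive slack at \<open>t\<close> makes \<open>f\<close> positive on the ideal, so the subtraction never truncates.\<close>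
    have "1 \<le> f t" using slack_partitionsD(2)[OF f t] by simp
    then have "1 \<le> f i" if "(i, t) \<in> P" for i
      using slack_partitions_antimono[OF f that] by simp
    then have "raise_below t g = f"
      by (intro PiE_ext[OF _ fE]) (auto simp: raise_below_def g_def)
    moreover have "g \<in> {1..n} \<rightarrow>\<^sub>E UNIV" by (simp add: g_def)
    ultimately show "f \<in> raise_below t ` slack_partitions d S"
      using f raise_below_in_slack_partitions by (metis imageI)
  qed
qed

lemma down_set_subset: "down_set P t \<subseteq> {1..n}"
  using P_subset by (auto simp: down_set_def)

lemma exponent_raise_below:
  "exponent n (raise_below t f) = mset_set (down_set P t) + exponent n f"
proof (rule multiset_eqI)
  fix i
  have "finite (down_set P t)" using down_set_subset finite_subset by blast
  then show "count (exponent n (raise_below t f)) i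
      = count (mset_set (down_set P t) + exponent n f) i"
    using P_subset by (auto simp: count_exponent count_mset_set' down_set_def raise_below_def)
qed

definition slack_series :: "(nat \<Rightarrow> nat) \<Rightarrow> nat set \<Rightarrow> (nat, int) mps" where
  "slack_series d S = monomial_series (exponent n ` slack_partitions d S)"

lemma slack_series_shift:
  assumes "t \<in> {1..n}"
  shows "slack_series (d(t := Suc (d t))) S = X_set (down_set P t) * slack_series d S"
  unfolding slack_series_def raise_below_slack_partitions[OF assms, symmetric]
  by (simp add: X_set_eq monomial_series_shift image_image exponent_raise_below)

text \<open>
  Either the slack at \<open>t\<close> is minimal or it exceeds \<open>d t\<close>. The latter functions are a shifted copy
  of the whole class, which sums the geometric series.
\<close>

lemma slack_series_free:
  assumes t: "t \<in> {1..n}" "t \<notin> S"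
  shows "slack_series d (insert t S) * (1 - X_set (down_set P t)) = slack_series d S"
proof -
  let ?d = "d(t := Suc (d t))"
  have un: "slack_partitions d (insert t S) = slack_partitions d S \<union> slack_partitions ?d (insert t S)"
  proof (intro equalityI subsetI)
    fix f assume f: "f \<in> slack_partitions d (insert t S)"
    show "f \<in> slack_partitions d S \<union> slack_partitions ?d (insert t S)"
    proof (cases "f t = cover_value f t + d t")
      case True
      with f show ?thesis by (auto simp: slack_partitions_def)
    next
      case False
      moreover have "cover_value f t + d t \<le> f t"
        using f t(1) by (rule slack_partitionsD)
      ultimately have "cover_value f t + Suc (d t) \<le> f t" by simp
      with f show ?thesis by (auto simp: slack_partitions_def)
    qed
  next
    fix f assume "f \<in> slack_partitions d S \<union> slack_partitions ?d (insert t S)"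
    then show "f \<in> slack_partitions d (insert t S)"
      by (fastforce simp: slack_partitions_def split: if_splits)
  qed
  have disj: "slack_partitions d S \<inter> slack_partitions ?d (insert t S) = {}"
  proof (intro equals0I, elim IntE)
    fix f assume f: "f \<in> slack_partitions d S" "f \<in> slack_partitions ?d (insert t S)"
    show False
      using slack_partitionsD(3)[OF f(1) t] slack_partitionsD(2)[OF f(2) t(1)] by simp
  qed
  have "exponent n ` slack_partitions d S \<inter> exponent n ` slack_partitions ?d (insert t S) = {}"
  proof -
    have "slack_partitions e T \<subseteq> {1..n} \<rightarrow>\<^sub>E UNIV" for e T
      using slack_partitionsD(1) by blast
    from inj_on_image_Int[OF inj_on_exponent this this] show ?thesis
      using disj by (metis image_empty)
  qed
  then have "slack_series d (insert t S) = slack_series d S + slack_series ?d (insert t S)"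
    by (simp add: slack_series_def un image_Un monomial_series_Un)
  then show ?thesis
    by (simp add: slack_series_shift[OF t(1)] algebra_simps)
qed

text \<open>
  Zero slack everywhere forces the value \<open>0\<close> at the roots and copies it downwards along covers,
  hence the induction over the converse order.
\<close>

lemma slack_partitions_zero: "slack_partitions (\<lambda>_. 0) {} = {restrict (\<lambda>_. 0) {1..n}}"
proof (intro equalityI subsetI)
  fix f assume f: "f \<in> slack_partitions (\<lambda>_. 0) {}"
  have "wf ((P - Id)\<inverse>)"
  proof -
    have "wf (P\<inverse> - Id)"
      using finite_P poset by (intro partial_order_on_well_order_on[where A = "{1..n}"]) simp_all
    moreover have "(P - Id)\<inverse> = P\<inverse> - Id" by auto
    ultimately show ?thesis by simp
  qed
  then have "i \<in> {1..n} \<longrightarrow> f i = 0" for i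
  proof (induction i rule: wf_induct_rule)
    case (less i)
    show ?case
    proof
      assume i: "i \<in> {1..n}"
      have "f i = cover_value f i" using slack_partitionsD(3)[OF f i] by simp
      moreover have "cover_value f i = 0"
      proof (cases "\<exists>j. covered_by P i j")
        case True
        then obtain j where j: "covered_by P i j" by blast
        with less.IH[of j] covered_byD[OF j] show ?thesis by (simp add: cover_value_eq)
      qed (simp add: cover_value_root)
      ultimately show "f i = 0" by simp
    qed
  qed
  moreover have "f \<in> {1..n} \<rightarrow>\<^sub>E UNIV" using f by (simp add: slack_partitions_def)
  ultimately have "f = restrict (\<lambda>_. 0) {1..n}"
    by (intro PiE_ext[where k = "{1..n}" and s = "\<lambda>_. UNIV"]) auto
  then show "f \<in> {restrict (\<lambda>_. 0) {1..n}}" by simp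
next
  fix f :: "nat \<Rightarrow> nat" assume "f \<in> {restrict (\<lambda>_. 0) {1..n}}"
  moreover have "cover_value (restrict (\<lambda>_. 0) {1..n}) i = 0" for i
    using covered_byD(5) by (auto simp: cover_value_def)
  ultimately show "f \<in> slack_partitions (\<lambda>_. 0) {}"
    by (auto simp: slack_partitions_def)
qed

lemma slack_series_zero: "slack_series (\<lambda>_. 0) {} = 1"
proof -
  have "exponent n (restrict (\<lambda>_. 0) {1..n}) = {#}" by (simp add: exponent_def)
  then show ?thesis
    by (simp add: slack_series_def slack_partitions_zero monomial_series_one)
qed

lemma slack_series_numerator:
  assumes "finite D" "D \<subseteq> {1..n}"
  shows "slack_series (\<lambda>i. of_bool (i \<in> D)) {} = (\<Prod>i\<in>D. X_set (down_set P i))"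
  using assms
proof (induction D rule: finite_induct)
  case empty
  then show ?case by (simp add: slack_series_zero)
next
  case (insert t D)
  let ?d = "\<lambda>i. of_bool (i \<in> D) :: nat"
  have "(\<lambda>i. of_bool (i \<in> insert t D)) = ?d(t := Suc (?d t))"
    using insert.hyps by auto
  then have "slack_series (\<lambda>i. of_bool (i \<in> insert t D)) {}
      = X_set (down_set P t) * slack_series ?d {}"
    using slack_series_shift[of t ?d "{}"] insert.prems by simp
  with insert show ?case by simp
qed

lemma slack_series_denominator:
  assumes "finite S" "S \<subseteq> {1..n}"
  shows "slack_series d S * (\<Prod>i\<in>S. 1 - X_set (down_set P i)) = slack_series d {}"
  using assms
proof (induction S rule: finite_induct)
  case (insert t S)
  have "slack_series d (insert t S) * (\<Prod>i\<in>insert t S. 1 - X_set (down_set P i))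
      = (slack_series d (insert t S) * (1 - X_set (down_set P t)))
          * (\<Prod>i\<in>S. 1 - X_set (down_set P i))"
    using insert.hyps by (simp add: mult.assoc)
  also have "\<dots> = slack_series d {}"
    using insert by (simp add: slack_series_free)
  finally show ?case .
qed simp

lemma P_partitions_eq_slack_partitions:
  "P_partitions n P = slack_partitions (\<lambda>i. of_bool (i \<in> Domain (Des P))) {1..n}"
    (is "_ = slack_partitions ?d _")
proof (intro equalityI subsetI)
  fix f assume f: "f \<in> P_partitions n P"
  have "cover_value f i + ?d i \<le> f i" for i
  proof (cases "\<exists>j. covered_by P i j")
    case True
    then obtain j where j: "covered_by P i j" by blast
    have "f j \<le> f i" using f covered_byD(3)[OF j] by (simp add: P_partitions_def)
    moreover have "f j < f i" if "i \<in> Domain (Des P)"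
    proof -
      from that have "(i, j) \<in> Des P" using j cover_unique by (auto simp: Des_def)
      then show ?thesis using f by (auto simp: P_partitions_def)
    qed
    ultimately show ?thesis by (cases "i \<in> Domain (Des P)") (simp_all add: cover_value_eq[OF j])
  next
    case False
    then show ?thesis by (auto simp: cover_value_root Des_def)
  qed
  then show "f \<in> slack_partitions ?d {1..n}"
    using f by (simp add: slack_partitions_def P_partitions_def)
next
  fix f assume f: "f \<in> slack_partitions ?d {1..n}"
  have "f j < f i" if "(i, j) \<in> Des P" for i j
  proof -
    have j: "covered_by P i j" and "?d i = 1" using that by (auto simp: Des_def)
    moreover have "cover_value f i + ?d i \<le> f i"
      using f covered_byD(4)[OF j] by (rule slack_partitionsD)
    ultimately show ?thesis by (simp add: cover_value_eq[OF j])
  qed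
  moreover have "f j \<le> f i" if "strictly_below P i j" for i j
    using slack_partitions_antimono[OF f] that by (simp add: strictly_below_def)
  ultimately show "f \<in> P_partitions n P"
    using f by (auto simp: P_partitions_def slack_partitions_def)
qed

theorem Hilbert_P_partitions:
  "Hilbert n (P_partitions n P)
     = (\<Prod>(i, j)\<in>Des P. X_set (down_set P i)) / (\<Prod>i=1..n. 1 - X_set (down_set P i))"
proof -
  let ?D = "Domain (Des P)" and ?den = "\<Prod>i=1..n. 1 - X_set (down_set P i)"
  have D: "finite ?D" "?D \<subseteq> {1..n}"
    using finite_Domain[OF finite_Des] covered_byD(4) by (blast, auto simp: Des_def)
  have "inj_on fst (Des P)" using cover_unique by (auto simp: inj_on_def Des_def)
  then have num: "(\<Prod>(i, j)\<in>Des P. X_set (down_set P i)) = (\<Prod>i\<in>?D. X_set (down_set P i))"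
    by (simp add: Domain_fst prod.reindex case_prod_unfold)
  have "?den dvd (\<Prod>i=1..n. 1)"
  proof (rule prod_dvd_prod)
    fix i assume "i \<in> {1..n}"
    then have "down_set P i \<noteq> {}" "finite (down_set P i)"
      using P_refl down_set_subset finite_subset by (fastforce simp: down_set_def)+
    then show "1 - X_set (down_set P i) dvd 1" by (simp add: one_minus_X_set_unit)
  qed
  then have unit: "?den dvd 1" by simp
  have "Hilbert n (P_partitions n P) = slack_series (\<lambda>i. of_bool (i \<in> ?D)) {1..n}"
    unfolding slack_series_def P_partitions_eq_slack_partitions
    by (rule Hilbert_eq) (auto simp: slack_partitions_def)
  moreover have "slack_series (\<lambda>i. of_bool (i \<in> ?D)) {1..n} * ?den = (\<Prod>i\<in>?D. X_set (down_set P i))"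
    by (simp add: slack_series_denominator slack_series_numerator[OF D])
  ultimately show ?thesis
    unfolding num using mps_divide_eq_iff[OF unit] by metis
qed

end

section \<open>Chains\<close>

definition chain_order :: "nat \<Rightarrow> (nat \<Rightarrow> nat) \<Rightarrow> nat rel" where
  "chain_order n w = {(w a, w b) | a b. 1 \<le> a \<and> a \<le> b \<and> b \<le> n}"

lemma permutes_eq_iff: "w permutes A \<Longrightarrow> w a = w b \<longleftrightarrow> a = b"
  by (metis permutes_inverses(2))

lemma strictly_below_chain_order:
  assumes "w permutes {1..n}"
  shows "strictly_below (chain_order n w) i j \<longleftrightarrow>
    (\<exists>a b. 1 \<le> a \<and> a < b \<and> b \<le> n \<and> i = w a \<and> j = w b)"
  unfolding strictly_below_def chain_order_def
  by (auto simp: permutes_eq_iff[OF assms] le_less)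

lemma covered_by_chain_order:
  assumes w: "w permutes {1..n}"
  shows "covered_by (chain_order n w) i j \<longleftrightarrow>
    (\<exists>a. 1 \<le> a \<and> a + 1 \<le> n \<and> i = w a \<and> j = w (a + 1))"
proof
  assume c: "covered_by (chain_order n w) i j"
  then obtain a b where ab: "1 \<le> a" "a < b" "b \<le> n" "i = w a" "j = w b"
    by (auto simp: covered_by_def strictly_below_chain_order[OF w])
  have "\<not> a + 1 < b"
  proof
    assume "a + 1 < b"
    then have "strictly_below (chain_order n w) i (w (a + 1))"
      "strictly_below (chain_order n w) (w (a + 1)) j"
      unfolding strictly_below_chain_order[OF w] using ab
      by (intro exI[of _ a] exI[of _ "a + 1"] exI[of _ b]; simp)+
    with c show False by (auto simp: covered_by_def)
  qed
  then have "b = a + 1" using ab by simp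
  with ab show "\<exists>a. 1 \<le> a \<and> a + 1 \<le> n \<and> i = w a \<and> j = w (a + 1)" by auto
next
  assume "\<exists>a. 1 \<le> a \<and> a + 1 \<le> n \<and> i = w a \<and> j = w (a + 1)"
  then obtain a where a: "1 \<le> a" "a + 1 \<le> n" "i = w a" "j = w (a + 1)" by blast
  then have "strictly_below (chain_order n w) i j"
    unfolding strictly_below_chain_order[OF w] by (intro exI[of _ a] exI[of _ "a + 1"]) simp
  with a show "covered_by (chain_order n w) i j"
    by (auto simp: covered_by_def strictly_below_chain_order[OF w] permutes_eq_iff[OF w])
qed

lemma labeled_forest_chain_order:
  assumes w: "w permutes {1..n}"
  shows "labeled_forest n (chain_order n w)"
proof
  have "chain_order n w \<subseteq> {1..n} \<times> {1..n}"
  proof -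
    have "w a \<in> {1..n}" if "1 \<le> a" "a \<le> n" for a
      using that permutes_in_image[OF w, of a] by simp
    then show ?thesis unfolding chain_order_def by fastforce
  qed
  moreover have "refl_on {1..n} (chain_order n w)"
  proof (rule refl_onI)
    fix i assume "i \<in> {1..n}"
    then obtain a where "a \<in> {1..n}" "i = w a"
      using permutes_image[OF w] by blast
    then show "(i, i) \<in> chain_order n w" by (auto simp: chain_order_def)
  qed
  moreover have "trans (chain_order n w)"
  proof (rule transI)
    fix i j k assume "(i, j) \<in> chain_order n w" "(j, k) \<in> chain_order n w"
    then obtain a b c where "1 \<le> a" "a \<le> b" "b \<le> c" "c \<le> n" "i = w a" "k = w c"
      by (auto simp: chain_order_def permutes_eq_iff[OF w])
    then show "(i, k) \<in> chain_order n w"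
      unfolding chain_order_def mem_Collect_eq by (intro exI[of _ a] exI[of _ c]) simp
  qed
  moreover have "antisym (chain_order n w)"
    by (rule antisymI) (auto simp: chain_order_def permutes_eq_iff[OF w])
  ultimately show "partial_order_on {1..n} (chain_order n w)"
    by (simp add: partial_order_on_def preorder_on_def)
  show "forest (chain_order n w)"
    by (auto simp: forest_def covered_by_chain_order[OF w] permutes_eq_iff[OF w])
qed

lemma down_set_chain_order:
  assumes "w permutes {1..n}" "i \<in> {1..n}"
  shows "down_set (chain_order n w) (w i) = w ` {1..i}"
  using assms(2) by (auto simp: down_set_def chain_order_def permutes_eq_iff[OF assms(1)])

lemma Des_chain_order:
  assumes "w permutes {1..n}"
  shows "Des (chain_order n w)
    = (\<lambda>a. (w a, w (a + 1))) ` {a. 1 \<le> a \<and> a + 1 \<le> n \<and> w a > w (a + 1)}"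
  by (auto simp: Des_def covered_by_chain_order[OF assms])

lemma Hilbert_chain_order:
  assumes w: "w permutes {1..n}"
  shows "Hilbert n (P_partitions n (chain_order n w)) =
    (\<Prod>i\<in>{i. 1 \<le> i \<and> i + 1 \<le> n \<and> w i > w (i + 1)}. X_set (w ` {1..i}))
      / (\<Prod>i=1..n. 1 - X_set (w ` {1..i}))"
proof -
  let ?C = "chain_order n w" and ?I = "{i. 1 \<le> i \<and> i + 1 \<le> n \<and> w i > w (i + 1)}"
  interpret labeled_forest n ?C by (rule labeled_forest_chain_order[OF w])
  have "inj_on (\<lambda>a. (w a, w (a + 1))) ?I"
    by (auto simp: inj_on_def permutes_eq_iff[OF w])
  then have "(\<Prod>(i, j)\<in>Des ?C. X_set (down_set ?C i)) = (\<Prod>i\<in>?I. X_set (down_set ?C (w i)))"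
    unfolding Des_chain_order[OF w] by (simp add: prod.reindex)
  also have "\<dots> = (\<Prod>i\<in>?I. X_set (w ` {1..i}))"
    by (rule prod.cong) (auto simp: down_set_chain_order[OF w])
  finally have num: "(\<Prod>(i, j)\<in>Des ?C. X_set (down_set ?C i)) = (\<Prod>i\<in>?I. X_set (w ` {1..i}))" .
  have "(\<Prod>i=1..n. 1 - X_set (down_set ?C i)) = (\<Prod>i=1..n. 1 - X_set (down_set ?C (w i)))"
    by (rule prod.reindex_bij_betw[OF permutes_imp_bij[OF w], symmetric])
  also have "\<dots> = (\<Prod>i=1..n. 1 - X_set (w ` {1..i}))"
    by (rule prod.cong) (auto simp: down_set_chain_order[OF w])
  finally show ?thesis unfolding Hilbert_P_partitions num by simp
qed

lemma P_partitions_chain_order_iff: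
  assumes w: "w permutes {1..n}"
  shows "f \<in> P_partitions n (chain_order n w) \<longleftrightarrow>
    f \<in> {1..n} \<rightarrow>\<^sub>E UNIV \<and> strict_mono_on {1..n} (partition_key f \<circ> w)"
proof -
  interpret labeled_forest n "chain_order n w" by (rule labeled_forest_chain_order[OF w])
  have "strict_mono_on {1..n} (partition_key f \<circ> w) \<longleftrightarrow>
      (\<forall>a b. 1 \<le> a \<and> a < b \<and> b \<le> n \<longrightarrow> partition_key f (w a) < partition_key f (w b))"
    by (auto simp: strict_mono_on_def)
  then show ?thesis
    unfolding P_partitions_iff_partition_key strictly_below_chain_order[OF w] by blast
qed

section \<open>Sorting decomposes the partitions by linear extensions\<close>

text \<open>
  Read as the word \<open>w 1, \<dots>, w n\<close>, such a permutation is the sorted list of the labels without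
  repetitions; distinct keys leave no ties, which gives uniqueness.
\<close>

lemma ex1_sorting_permutation:
  fixes k :: "nat \<Rightarrow> 'b::linorder"
  assumes inj: "inj_on k {1..n}"
  shows "\<exists>!w. w permutes {1..n} \<and> strict_mono_on {1..n} (k \<circ> w)"
proof (rule ex_ex1I)
  define xs where "xs = sort_key k [1..<Suc n]"
  have len: "length xs = n" and set: "set xs = {1..n}" and dist: "distinct xs"
    and sorted: "sorted (map k xs)"
    by (auto simp: xs_def)
  have smap: "sorted_wrt (<) (map k xs)"
    using sorted inj dist set by (simp add: strict_sorted_iff distinct_map)
  define w where "w i = (if i \<in> {1..n} then xs ! (i - 1) else i)" for i
  have "bij_betw w {1..n} {1..n}"
  proof -
    have "w ` {1..n} = {1..n}"
    proof -
      have "{1..n} = Suc ` {..<n}" by (simp add: image_Suc_lessThan)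
      then have "w ` {1..n} = (!) xs ` {..<n}"
        by (simp add: image_image w_def)
      also have "\<dots> = {1..n}" using len set by (metis nth_image order_refl take_all atLeast0LessThan)
      finally show ?thesis .
    qed
    then show ?thesis by (simp add: bij_betw_def eq_card_imp_inj_on)
  qed
  then have "w permutes {1..n}" by (rule bij_imp_permutes) (simp only: w_def if_False)
  moreover have "strict_mono_on {1..n} (k \<circ> w)"
    using smap len unfolding sorted_wrt_iff_nth_less strict_mono_on_def
    by (auto simp: w_def)
  ultimately show "\<exists>w. w permutes {1..n} \<and> strict_mono_on {1..n} (k \<circ> w)" by blast
next
  fix w v assume w: "w permutes {1..n} \<and> strict_mono_on {1..n} (k \<circ> w)"
    and v: "v permutes {1..n} \<and> strict_mono_on {1..n} (k \<circ> v)"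
  let ?N = "[1..<Suc n]"
  have list: "sorted (map k (map u ?N))" "distinct (map k (map u ?N))" "set (map u ?N) = {1..n}"
    if "u permutes {1..n} \<and> strict_mono_on {1..n} (k \<circ> u)" for u
  proof -
    have "sorted_wrt (<) (map k (map u ?N))"
      unfolding sorted_wrt_map
      by (rule sorted_wrt_mono_rel[OF _ sorted_wrt_upt])
        (use that in \<open>auto simp: strict_mono_on_def\<close>)
    then show "sorted (map k (map u ?N))" "distinct (map k (map u ?N))"
      by (simp_all only: strict_sorted_iff)
    show "set (map u ?N) = {1..n}"
      using that permutes_image[of u "{1..n}"]
      by (simp only: set_map set_upt atLeastLessThanSuc_atLeastAtMost)
  qed
  have "map w ?N = map v ?N"
    by (rule map_sorted_distinct_set_unique[where f = k])
      (use inj list[OF w] list[OF v] in simp_all)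
  then have "w i = v i" if "i \<in> {1..n}" for i
    using that by (auto simp only: map_eq_conv set_upt atLeastLessThanSuc_atLeastAtMost)
  then show "w = v" using w v by (metis ext permutes_not_in)
qed

text \<open>
  The chain of \<open>w\<close> refines \<open>P\<close> when \<open>w\<close> is a linear extension, and conversely the permutation that
  sorts the keys of a \<open>P\<close>-partition must list \<open>P\<close> in order.
\<close>

lemma (in labeled_poset) P_partitions_eq_UN:
  "P_partitions n P = (\<Union>w\<in>linear_extensions n P. P_partitions n (chain_order n w))"
proof (intro equalityI subsetI)
  fix f assume f: "f \<in> P_partitions n P"
  obtain w where w: "w permutes {1..n}" and mono: "strict_mono_on {1..n} (partition_key f \<circ> w)"
    using ex1_sorting_permutation[OF inj_partition_key[of f]] by blast
  have "a < b" if ab: "a \<in> {1..n}" "b \<in> {1..n}" "strictly_below P (w a) (w b)" for a b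
  proof -
    have "partition_key f (w a) < partition_key f (w b)"
      using f ab(3) by (simp add: P_partitions_iff_partition_key)
    then show ?thesis
      using strict_mono_on_less[OF mono ab(1,2)] by simp
  qed
  then have "w \<in> linear_extensions n P" using w by (auto simp: linear_extensions_def)
  moreover have "f \<in> P_partitions n (chain_order n w)"
    using f mono by (simp add: P_partitions_chain_order_iff[OF w] P_partitions_iff_partition_key)
  ultimately show "f \<in> (\<Union>w\<in>linear_extensions n P. P_partitions n (chain_order n w))" by blast
next
  fix f assume "f \<in> (\<Union>w\<in>linear_extensions n P. P_partitions n (chain_order n w))"
  then obtain w where L: "w \<in> linear_extensions n P" and f: "f \<in> P_partitions n (chain_order n w)"
    by blast
  from L have w: "w permutes {1..n}" by (simp add: linear_extensions_def)
  from f have fE: "f \<in> {1..n} \<rightarrow>\<^sub>E UNIV" and mono: "strict_mono_on {1..n} (partition_key f \<circ> w)"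
    by (simp_all add: P_partitions_chain_order_iff[OF w])
  have "partition_key f i < partition_key f j" if ij: "strictly_below P i j" for i j
  proof -
    have "i \<in> w ` {1..n}" "j \<in> w ` {1..n}"
      using ij P_subset permutes_image[OF w] by (auto simp: strictly_below_def)
    then obtain a b where ab: "a \<in> {1..n}" "b \<in> {1..n}" "i = w a" "j = w b" by blast
    with L ij have "a < b" by (simp add: linear_extensions_def)
    with mono ab show ?thesis by (auto simp: strict_mono_on_def)
  qed
  with fE show "f \<in> P_partitions n P" by (simp add: P_partitions_iff_partition_key)
qed

lemma (in labeled_poset) Hilbert_P_partitions_eq_sum:
  "Hilbert n (P_partitions n P)
     = (\<Sum>w\<in>linear_extensions n P. Hilbert n (P_partitions n (chain_order n w)))"
proof -
  let ?L = "linear_extensions n P" and ?E = "{1..n} \<rightarrow>\<^sub>E UNIV :: (nat \<Rightarrow> nat) set"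
  have perm: "w permutes {1..n}" if "w \<in> ?L" for w
    using that by (simp add: linear_extensions_def)
  have sub: "P_partitions n Q \<subseteq> ?E" for Q by (auto simp: P_partitions_def)
  have "finite ?L"
    by (rule finite_subset[OF _ finite_permutations[of "{1..n}"]]) (use perm in auto)
  moreover have "disjoint_family_on (\<lambda>w. exponent n ` P_partitions n (chain_order n w)) ?L"
    unfolding disjoint_family_on_def
  proof (intro ballI impI)
    fix w v assume wv: "w \<in> ?L" "v \<in> ?L" "w \<noteq> v"
    have "P_partitions n (chain_order n w) \<inter> P_partitions n (chain_order n v) = {}"
    proof (intro equals0I, elim IntE)
      fix f assume "f \<in> P_partitions n (chain_order n w)" "f \<in> P_partitions n (chain_order n v)"
      then have "strict_mono_on {1..n} (partition_key f \<circ> w)"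
        "strict_mono_on {1..n} (partition_key f \<circ> v)"
        using P_partitions_chain_order_iff perm wv by blast+
      with ex1_sorting_permutation[OF inj_partition_key[of f]] perm wv show False by blast
    qed
    then show "exponent n ` P_partitions n (chain_order n w)
        \<inter> exponent n ` P_partitions n (chain_order n v) = {}"
      using inj_on_image_Int[OF inj_on_exponent sub sub] by (metis image_empty)
  qed
  ultimately have "monomial_series (\<Union>w\<in>?L. exponent n ` P_partitions n (chain_order n w))
      = (\<Sum>w\<in>?L. monomial_series (exponent n ` P_partitions n (chain_order n w)) :: (nat, int) mps)"
    by (rule monomial_series_UN)
  then have "monomial_series (exponent n ` P_partitions n P)
      = (\<Sum>w\<in>?L. monomial_series (exponent n ` P_partitions n (chain_order n w)) :: (nat, int) mps)"
    by (simp only: P_partitions_eq_UN image_UN)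
  then show ?thesis by (simp add: Hilbert_eq[OF sub])
qed

theorem proposition6p1:
  fixes n :: nat and P :: "nat rel"
  assumes poset: "partial_order_on {1..n} P"
    and forest: "forest P"
  shows "Hilbert n (P_partitions n P)
           = (\<Prod>(i, j)\<in>Des P. X_set (down_set P i)) / (\<Prod>i=1..n. 1 - X_set (down_set P i))
       \<and> (\<Prod>(i, j)\<in>Des P. X_set (down_set P i)) / (\<Prod>i=1..n. 1 - X_set (down_set P i))
           = (\<Sum>w\<in>linear_extensions n P.
                (\<Prod>i\<in>{i. 1 \<le> i \<and> i + 1 \<le> n \<and> w i > w (i + 1)}. X_set (w ` {1..i}))
                  / (\<Prod>i=1..n. 1 - X_set (w ` {1..i})))"
proof -
  interpret labeled_forest n P using poset forest by unfold_locales
  have "Hilbert n (P_partitions n P) = (\<Sum>w\<in>linear_extensions n P.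
                (\<Prod>i\<in>{i. 1 \<le> i \<and> i + 1 \<le> n \<and> w i > w (i + 1)}. X_set (w ` {1..i}))
                  / (\<Prod>i=1..n. 1 - X_set (w ` {1..i})))"
    unfolding Hilbert_P_partitions_eq_sum
    by (rule sum.cong[OF refl Hilbert_chain_order]) (simp add: linear_extensions_def)
  with Hilbert_P_partitions show ?thesis by metis
qed

end
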